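(* For $l\le4$, let $\underline k=(k_1,\dots,k_{2m},k_{2m+1},\dots,k_{2m+l})\in(\mathbb Z\setminus\{0\})^{2m+l}$ be such that $k_{2j-1}=k_{2j}$ for $j=1,\dots,m$. Then $\underline k$ is $\mathbb R$-admissible if and only if there are $\kappa_j\in\{1,-1\}$, $j=1,\dots,2m+l$, such that $$\sum_{j=1}^{2m+l}\kappa_jk_j=0.$$
   Context: Here $m,l$ are non-negative integers. For $\underline k=(k_1,\dots,k_n)\in\mathbb Z^n$ and $z\in U(1)=\{z\in\mathbb C\mid|z|=1\}$ let $z^{\underline k}$ be the diagonal matrix $\mathrm{diag}(z^{k_1},\dots,z^{k_n})$ acting on $\mathbb C^n$. A real subspace $V\subset\mathbb C^n$ is called $\underline k$-good if $\dim_{\mathbb R}V=n$ and $z^{\underline k}V\cap\mathbb R^n=\{0\}$ for all $z\in U(1)$. An $n$-tuple $\underline k\in(\mathbb Z\setminus\{0\})^n$ is called $\mathbb R$-admissible if there exists a $\underline k$-good subspace of $\mathbb C^n$. *)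

theory Defs
  imports "HOL-Analysis.Analysis" "HOL-Library.Function_Algebras"
begin

text \<open>
  Vectors of complex n-space are functions on the natural numbers supported on {1..n}, so that n
  (possibly 0) can be an ordinary number in statements. The pointwise real vector space structure
  on functions makes the library notions \<^const>\<open>subspace\<close> and \<^const>\<open>dim\<close> (over the reals) available.
\<close>

instantiation "fun" :: (type, real_vector) real_vector
begin

definition scaleR_fun_def: "r *\<^sub>R f = (\<lambda>x. r *\<^sub>R f x)"

instance
  by standard (auto simp: scaleR_fun_def fun_eq_iff plus_fun_def algebra_simps)

end

definition complex_space :: "nat \<Rightarrow> (nat \<Rightarrow> complex) set" where
  "complex_space n = {v. \<forall>j. j \<notin> {1..n} \<longrightarrow> v j = 0}"

definition real_space :: "nat \<Rightarrow> (nat \<Rightarrow> complex) set" where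
  "real_space n = {v \<in> complex_space n. \<forall>j. v j \<in> \<real>}"

text \<open>
  The action of the matrix diag(z^(k 1), ..., z^(k n)). There is no need to mention n, because
  coordinates outside the support of v stay 0.
\<close>

definition diag_act :: "(nat \<Rightarrow> int) \<Rightarrow> complex \<Rightarrow> (nat \<Rightarrow> complex) \<Rightarrow> nat \<Rightarrow> complex" where
  "diag_act k z v = (\<lambda>j. z powi k j * v j)"

definition good_subspace :: "nat \<Rightarrow> (nat \<Rightarrow> int) \<Rightarrow> (nat \<Rightarrow> complex) set \<Rightarrow> bool" where
  "good_subspace n k V \<longleftrightarrow>
     V \<subseteq> complex_space n \<and> subspace V \<and> dim V = n \<and>
     (\<forall>z. cmod z = 1 \<longrightarrow> diag_act k z ` V \<inter> real_space n = {0})"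

text \<open>Only the values of k on {1..n} matter; they represent the n-tuple.\<close>

definition R_admissible :: "nat \<Rightarrow> (nat \<Rightarrow> int) \<Rightarrow> bool" where
  "R_admissible n k \<longleftrightarrow> (\<forall>j\<in>{1..n}. k j \<noteq> 0) \<and> (\<exists>V. good_subspace n k V)"

end

theory Submission
  imports Defs "Jordan_Normal_Form.Determinant"
begin

text \<open>
  Write a good subspace as the image of an injective real matrix action x \<mapsto> (r j)(x) with complex
  rows r j. Goodness says that the real square matrix with rows Im (z^(k j) r j) is invertible for
  every unit z. Along z = cis t its determinant is a trigonometric polynomial with frequencies
  \<plusminus>(k 1) \<plusminus> ... \<plusminus> (k n); if none of them is 0, it is the derivative of a periodic function and
  vanishes somewhere by Rolle.

  Conversely, the signs of the k j may be changed by conjugating coordinates. Two entries (k, k)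
  can be split off as a complex line or absorbed, with the same determinant, into a third one:
  (a, k, k) is obtained from a + 2k. This leaves at most four integers with sum 0, some of them
  possibly 0. Unless they decompose into shorter tuples with sum 0, an explicit subspace has, up to a
  constant factor, determinant sin(Kt)^2 + cos(Lt + \<gamma>)^2 with K, L sums of two of the entries and a
  suitable phase \<gamma>.
\<close>

text \<open>\<open>M i\<close> is the \<open>i\<close>-th basis vector, and the condition is
  injectivity of the real matrix with rows indexed by \<open>j\<close>. An arbitrary index set lets
  coordinates be added anywhere, and entries of \<open>k\<close> may be \<open>0\<close> because
  merging a pair into another entry can produce zeros.\<close>

definition admissible_on :: "nat set \<Rightarrow> (nat \<Rightarrow> int) \<Rightarrow> bool" where
  "admissible_on J k \<longleftrightarrow> (\<exists>M :: nat \<Rightarrow> nat \<Rightarrow> complex. \<forall>z x. cmod z = 1 \<longrightarrow>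
     (\<forall>j\<in>J. Im (z powi k j * (\<Sum>i\<in>J. of_real (x i) * M i j)) = 0) \<longrightarrow> (\<forall>i\<in>J. x i = 0))"

lemma admissible_onI:
  assumes "\<And>z x i. cmod z = 1 \<Longrightarrow>
      (\<And>j. j \<in> J \<Longrightarrow> Im (z powi k j * (\<Sum>i\<in>J. of_real (x i) * M i j)) = 0) \<Longrightarrow> i \<in> J \<Longrightarrow> x i = 0"
  shows "admissible_on J k"
  using assms unfolding admissible_on_def by blast

lemma admissible_onE:
  assumes "admissible_on J k"
  obtains M where "\<And>z x i. cmod z = 1 \<Longrightarrow>
      (\<And>j. j \<in> J \<Longrightarrow> Im (z powi k j * (\<Sum>i\<in>J. of_real (x i) * M i j)) = 0) \<Longrightarrow> i \<in> J \<Longrightarrow> x i = 0"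
  using assms unfolding admissible_on_def by metis

section \<open>Good subspaces as column spaces\<close>

lemma fun_sum_apply: "(\<Sum>i\<in>A. f i) x = (\<Sum>i\<in>A. f i x)"
  for f :: "'a \<Rightarrow> 'b \<Rightarrow> 'c::comm_monoid_add"
  by (induction A rule: infinite_finite_induct) auto

text \<open>Injectivity at \<open>z = 1\<close> makes the vectors \<open>M i\<close> linearly
  independent, so their span has dimension \<open>n\<close>; injectivity at the other
  \<open>z\<close> excludes nonzero vectors that become real.\<close>

lemma admissible_on_imp_good_subspace:
  assumes "admissible_on {1..n} k"
  shows "\<exists>V. good_subspace n k V"
proof -
  define J where "J = {1..n}"
  obtain M where M: "\<And>z x i. cmod z = 1 \<Longrightarrow>
      (\<And>j. j \<in> J \<Longrightarrow> Im (z powi k j * (\<Sum>i\<in>J. of_real (x i) * M i j)) = 0) \<Longrightarrow> i \<in> J \<Longrightarrow> x i = 0"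
    using admissible_onE[OF assms[folded J_def]] by blast
  define e where "e i = (\<lambda>j. if j \<in> J then M i j else 0)" for i
  have comb: "(\<Sum>i\<in>J. x i *\<^sub>R e i) j = (if j \<in> J then \<Sum>i\<in>J. of_real (x i) * M i j else 0)" for x j
    by (simp add: fun_sum_apply scaleR_fun_def e_def scaleR_conv_of_real)
  have zero: "x i = 0" if "(\<Sum>i\<in>J. x i *\<^sub>R e i) = 0" "i \<in> J" for x i
  proof (rule M[of 1])
    fix j assume "j \<in> J"
    then show "Im (1 powi k j * (\<Sum>i\<in>J. of_real (x i) * M i j)) = 0"
      using comb[of x j] that(1) by simp
  qed (use that in auto)
  \<comment> \<open>Independence is a property of the image as a set, so repeated vectors have to be
    excluded separately.\<close>
  have inj: "inj_on e J"
  proof (rule inj_onI, rule ccontr)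
    fix a b assume ab: "a \<in> J" "b \<in> J" "e a = e b" "a \<noteq> b"
    have "(\<Sum>i\<in>J. ((if i = a then 1 else 0) - (if i = b then 1 else 0)) *\<^sub>R e i) = e a - e b"
      using ab by (simp add: scaleR_left_diff_distrib sum_subtractf if_distrib[of "\<lambda>c. c *\<^sub>R _"]
          J_def cong: if_cong)
    with zero[of "\<lambda>i. (if i = a then 1 else 0) - (if i = b then 1 else 0)" a] ab show False
      by simp
  qed
  have fin: "finite (e ` J)" by (simp add: J_def)
  have ind: "independent (e ` J)"
    using zero[of "\<lambda>i. c (e i)" for c] inj
    unfolding dependent_finite[OF fin] by (auto simp: sum.reindex)
  define V where "V = span (e ` J)"
  have V_eq: "\<exists>x. v = (\<Sum>i\<in>J. x i *\<^sub>R e i)" if "v \<in> V" for v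
  proof -
    obtain c where "v = (\<Sum>v\<in>e ` J. c v *\<^sub>R v)"
      using \<open>v \<in> V\<close> fin unfolding V_def span_finite[OF fin] by auto
    then show ?thesis
      using inj by (intro exI[of _ "\<lambda>i. c (e i)"]) (simp add: sum.reindex)
  qed
  have "good_subspace n k V"
    unfolding good_subspace_def
  proof (intro conjI allI impI)
    show "V \<subseteq> complex_space n"
      using V_eq comb by (force simp: complex_space_def J_def)
    show "subspace V" by (simp add: V_def subspace_span)
    show "dim V = n"
      unfolding V_def dim_span_eq_card_independent[OF ind] using inj by (simp add: card_image J_def)
    fix z :: complex assume z: "cmod z = 1"
    show "diag_act k z ` V \<inter> real_space n = {0}"
    proof (intro equalityI subsetI)
      fix u assume "u \<in> diag_act k z ` V \<inter> real_space n"
      then obtain v where v: "v \<in> V" "u = diag_act k z v" "u \<in> real_space n" by blast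
      obtain x where x: "v = (\<Sum>i\<in>J. x i *\<^sub>R e i)" using V_eq v by blast
      have "x i = 0" if "i \<in> J" for i
      proof (rule M[OF z _ that])
        fix j assume "j \<in> J"
        then have "u j = z powi k j * (\<Sum>i\<in>J. of_real (x i) * M i j)"
          using comb[of x j] v(2) x by (simp add: diag_act_def)
        moreover have "u j \<in> \<real>" using v(3) by (simp add: real_space_def)
        ultimately show "Im (z powi k j * (\<Sum>i\<in>J. of_real (x i) * M i j)) = 0"
          by (simp add: complex_is_Real_iff)
      qed
      then have "v = 0" using x by simp
      then show "u \<in> {0}" using v by (simp add: diag_act_def fun_eq_iff)
    next
      fix u :: "nat \<Rightarrow> complex" assume "u \<in> {0}"
      moreover have "diag_act k z 0 = 0" by (simp add: diag_act_def fun_eq_iff)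
      moreover have "0 \<in> V" by (simp add: V_def span_zero)
      moreover have "0 \<in> real_space n" by (simp add: real_space_def complex_space_def)
      ultimately show "u \<in> diag_act k z ` V \<inter> real_space n"
        by (metis IntI image_eqI singletonD)
    qed
  qed
  then show ?thesis by blast
qed

lemma good_subspace_imp_admissible_on:
  assumes "good_subspace n k V"
  shows "admissible_on {1..n} k"
\<comment> \<open>For \<open>n = 0\<close>, \<open>card B = 0\<close> would not imply that
  \<open>B\<close> is finite.\<close>
proof (cases "n = 0")
  case True
  then show ?thesis by (simp add: admissible_on_def)
next
  case False
  have V: "V \<subseteq> complex_space n" "subspace V" "dim V = n"
    and good: "\<And>z. cmod z = 1 \<Longrightarrow> diag_act k z ` V \<inter> real_space n = {0}"
    using assms unfolding good_subspace_def by auto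
  obtain B where B: "B \<subseteq> V" "independent B" "V \<subseteq> span B" "card B = dim V"
    using basis_exists by blast
  then have finB: "finite B" using False V(3) card_ge_0_finite[of B] by simp
  then obtain e where e: "bij_betw e {1..n} B"
    using B(4) V(3) finite_same_card_bij[of "{1..n}" B] by auto
  show ?thesis
  proof (rule admissible_onI[where M = e])
    fix z x i
    assume z: "cmod z = 1" and i: "i \<in> {1..n}"
      and im: "\<And>j. j \<in> {1..n} \<Longrightarrow> Im (z powi k j * (\<Sum>i\<in>{1..n}. of_real (x i) * e i j)) = 0"
    define v where "v = (\<Sum>i\<in>{1..n}. x i *\<^sub>R e i)"
    have vj: "v j = (\<Sum>i\<in>{1..n}. of_real (x i) * e i j)" for j
      by (simp add: v_def fun_sum_apply scaleR_fun_def scaleR_conv_of_real)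
    have vV: "v \<in> V"
      unfolding v_def using e B(1) V(2)
      by (intro subspace_sum subspace_scale) (auto simp: bij_betw_def)
    have v0: "v j = 0" if "j \<notin> {1..n}" for j
      using vV V(1) that by (auto simp: complex_space_def)
    have "Im (z powi k j * v j) = 0" for j
      using im[of j] v0[of j] unfolding vj[symmetric] by (cases "j \<in> {1..n}") auto
    then have "diag_act k z v \<in> real_space n"
      using v0 by (simp add: real_space_def complex_space_def diag_act_def complex_is_Real_iff)
    then have "diag_act k z v = 0" using good[OF z] vV by blast
    moreover have "z \<noteq> 0" using z by auto
    ultimately have "v = 0" by (auto simp: diag_act_def fun_eq_iff)
    define c where "c b = x (inv_into {1..n} e b)" for b
    have "(\<Sum>b\<in>B. c b *\<^sub>R b) = v"
      unfolding v_def using e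
      by (subst sum.reindex_bij_betw[OF e, symmetric])
        (auto intro!: sum.cong simp: c_def bij_betw_def inv_into_f_f)
    then have "c b = 0" if "b \<in> B" for b
      using B(2) \<open>v = 0\<close> that dependent_finite[OF finB] by auto
    from this[of "e i"] show "x i = 0"
      using e i by (auto simp: c_def bij_betw_def inv_into_f_f)
  qed
qed

section \<open>Necessity\<close>

lemma trig_poly_without_constant_term_has_zero:
  fixes c :: "'a \<Rightarrow> complex" and m :: "'a \<Rightarrow> int"
  assumes "\<And>a. a \<in> A \<Longrightarrow> m a \<noteq> 0"
  shows "\<exists>t::real. Re (\<Sum>a\<in>A. c a * cis (m a * t)) = 0"
proof -
  define G where "G t = (\<Sum>a\<in>A. Re (c a * cis (m a * t) / (\<i> * m a)))" for t :: real
  have D: "(G has_real_derivative (\<Sum>a\<in>A. Re (c a * cis (m a * t)))) (at t)" for t :: real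
    unfolding G_def
  proof (rule DERIV_sum)
    fix a assume a: "a \<in> A"
    \<comment> \<open>In terms of real sine and cosine the summand can be differentiated
      directly.\<close>
    have "(\<lambda>t::real. Re (c a * cis (m a * t) / (\<i> * m a))) =
        (\<lambda>t::real. (Re (c a) * sin (m a * t) + Im (c a) * cos (m a * t)) / m a)"
      using assms[OF a] by (auto simp: fun_eq_iff Re_divide field_simps power2_eq_square)
    then show "((\<lambda>t. Re (c a * cis (m a * t) / (\<i> * m a))) has_real_derivative
        Re (c a * cis (m a * t))) (at t)"
      using assms[OF a] by (auto intro!: derivative_eq_intros simp: field_simps)
  qed
  \<comment> \<open>The frequencies are integers, so \<open>G\<close> has period
    \<open>2 * pi\<close>.\<close>
  have "G 0 = G (2 * pi)"
    unfolding G_def by (intro sum.cong refl) (simp add: mult.commute[of "of_int _" "2 * pi"])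
  moreover have "continuous_on {0..2 * pi} G"
    using D by (intro DERIV_continuous_on) (rule has_field_derivative_at_within)
  moreover have "G differentiable (at t)" for t
    using D real_differentiable_def by blast
  ultimately obtain t where "DERIV G t :> 0"
    using Rolle[of 0 "2 * pi" G] pi_gt_zero by auto
  with D[of t] have "(\<Sum>a\<in>A. Re (c a * cis (m a * t))) = 0"
    by (rule DERIV_unique)
  then show ?thesis by auto
qed

text \<open>Put as a sum, so that a product of imaginary parts expands over subsets by
  \<open>prod_add\<close>.\<close>

lemma Im_eq_cnj: "of_real (Im w) = (w + - cnj w) / (2 * \<i>)"
  by (simp add: complex_eq_iff)

text \<open>Expanding the determinant over permutations, and each product of imaginary parts over
  the set \<open>X\<close> of factors taken unconjugated, yields terms of frequency
  \<open>freq X\<close>. These are exactly the signed sums, so if none is \<open>0\<close> there is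
  no constant term.\<close>

lemma admissible_on_imp_signed_sum_zero:
  assumes "admissible_on {1..n} k"
  shows "\<exists>\<kappa> :: nat \<Rightarrow> int. (\<forall>j\<in>{1..n}. \<kappa> j \<in> {1, -1}) \<and> (\<Sum>j=1..n. \<kappa> j * k j) = 0"
proof (rule ccontr)
  assume contra: "\<not> ?thesis"
  \<comment> \<open>Matrix indices start at \<open>0\<close> and coordinates at \<open>1\<close>,
    hence the shifts by \<open>Suc\<close> and \<open>- 1\<close> below.\<close>
  define J where "J = {0..<n}"
  obtain M where M: "\<And>z x i. cmod z = 1 \<Longrightarrow>
      (\<And>j. j \<in> {1..n} \<Longrightarrow> Im (z powi k j * (\<Sum>i\<in>{1..n}. of_real (x i) * M i j)) = 0)
      \<Longrightarrow> i \<in> {1..n} \<Longrightarrow> x i = 0"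
    using admissible_onE[OF assms] by blast
  define freq where "freq X = (\<Sum>j\<in>X. k (Suc j)) - (\<Sum>j\<in>J-X. k (Suc j))" for X
  have freq: "freq X \<noteq> 0" if "X \<in> Pow J" for X
  proof
    assume 0: "freq X = 0"
    define \<kappa> :: "nat \<Rightarrow> int" where "\<kappa> j = (if j - 1 \<in> X then 1 else -1)" for j
    have "(\<Sum>j=1..n. \<kappa> j * k j) = (\<Sum>j\<in>J. \<kappa> (Suc j) * k (Suc j))"
      unfolding J_def by (rule sum.reindex_bij_witness[of _ Suc "\<lambda>j. j - 1"]) auto
    also have "\<dots> = (\<Sum>j\<in>X. \<kappa> (Suc j) * k (Suc j)) + (\<Sum>j\<in>J-X. \<kappa> (Suc j) * k (Suc j))"
      using that by (subst sum.subset_diff[of X]) (auto simp: J_def)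
    also have "\<dots> = freq X"
      by (simp add: \<kappa>_def freq_def sum_negf)
    finally show False
      using 0 contra by (metis \<kappa>_def insertCI)
  qed
  define A where "A t = mat n n (\<lambda>(r, c). Im (cis t powi k (Suc r) * M (Suc c) (Suc r)))" for t :: real
  have carrier: "A t \<in> carrier_mat n n" for t by (simp add: A_def)
  define N where "N p j = M (Suc (p j)) (Suc j)" for p j
  \<comment> \<open>The coefficient contributed by the permutation \<open>p\<close> and the choice
    \<open>X\<close>; each factor \<open>2 * \<i>\<close> comes from writing an imaginary part with
    conjugates.\<close>
  define C where "C p X = signof p * ((\<Prod>j\<in>X. N p j / (2 * \<i>)) * (\<Prod>j\<in>J-X. - cnj (N p j) / (2 * \<i>)))" for p X
  define S where "S = {p. p permutes J} \<times> Pow J"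
  have det_A: "of_real (Determinant.det (A t)) = (\<Sum>(p, X)\<in>S. C p X * cis (freq X * t))" for t :: real
  proof -
    have entry: "of_real (A t $$ (j, p j)) =
        N p j / (2 * \<i>) * cis (k (Suc j) * t) + - cnj (N p j) / (2 * \<i>) * cis (- (k (Suc j) * t))"
      if "p permutes J" "j \<in> J" for p j
    proof -
      have "p j < n" "j < n" using that permutes_in_image[of p J j] by (auto simp: J_def)
      then have "A t $$ (j, p j) = Im (cis (k (Suc j) * t) * N p j)"
        by (simp add: A_def N_def cis_power_int)
      then have "of_real (A t $$ (j, p j)) = (cis (k (Suc j) * t) * N p j +
          - (cis (- (k (Suc j) * t)) * cnj (N p j))) / (2 * \<i>)"
        by (simp only: Im_eq_cnj complex_cnj_mult cis_cnj)
      then show ?thesis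
        by (simp add: divide_simps del: of_real_minus) (simp add: algebra_simps)
    qed
    have cis_sum: "(\<Prod>j\<in>X. cis (g j)) = cis (\<Sum>j\<in>X. g j)" for X and g :: "nat \<Rightarrow> real"
      by (induction X rule: infinite_finite_induct) (auto simp: cis_mult)
    have "of_real (\<Prod>j\<in>J. A t $$ (j, p j)) = (\<Sum>X\<in>Pow J. (\<Prod>j\<in>X. N p j / (2 * \<i>)) *
        (\<Prod>j\<in>J-X. - cnj (N p j) / (2 * \<i>)) * cis (freq X * t))" if "p permutes J" for p
    proof -
      have "of_real (\<Prod>j\<in>J. A t $$ (j, p j)) = (\<Prod>j\<in>J.
          N p j / (2 * \<i>) * cis (k (Suc j) * t) + - cnj (N p j) / (2 * \<i>) * cis (- (k (Suc j) * t)))"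
        unfolding of_real_prod using entry[OF that] by (intro prod.cong) auto
      also have "\<dots> = (\<Sum>X\<in>Pow J. (\<Prod>j\<in>X. N p j / (2 * \<i>)) *
        (\<Prod>j\<in>J-X. - cnj (N p j) / (2 * \<i>)) * cis (freq X * t))"
      proof (subst prod_add, simp add: J_def, intro sum.cong refl)
        fix X
        have "cis (freq X * t) = cis (\<Sum>j\<in>X. k (Suc j) * t) * cis (\<Sum>j\<in>J-X. - (k (Suc j) * t))"
          by (simp add: cis_mult freq_def algebra_simps sum_distrib_left sum_negf)
        then show "(\<Prod>j\<in>X. N p j / (2 * \<i>) * cis (k (Suc j) * t)) *
          (\<Prod>j\<in>J-X. - cnj (N p j) / (2 * \<i>) * cis (- (k (Suc j) * t))) =
          (\<Prod>j\<in>X. N p j / (2 * \<i>)) * (\<Prod>j\<in>J-X. - cnj (N p j) / (2 * \<i>)) * cis (freq X * t)"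
          by (simp only: prod.distrib cis_sum mult_ac)
      qed
      finally show ?thesis .
    qed
    then have "of_real (Determinant.det (A t)) =
        (\<Sum>p | p permutes J. \<Sum>X\<in>Pow J. C p X * cis (freq X * t))"
      unfolding det_def'[OF carrier] J_def[symmetric] of_real_sum
      by (intro sum.cong) (auto simp: C_def sum_distrib_left mult_ac)
    then show ?thesis
      by (simp add: S_def sum.cartesian_product)
  qed
  \<comment> \<open>The determinant is real, so a zero of the real part of the expansion is a zero
    of the determinant; a kernel vector then contradicts injectivity.\<close>
  obtain t :: real where "Re (\<Sum>s\<in>S. C (fst s) (snd s) * cis (freq (snd s) * t)) = 0"
    using trig_poly_without_constant_term_has_zero[of S "\<lambda>s. freq (snd s)" "\<lambda>s. C (fst s) (snd s)"]
      freq by (auto simp: S_def)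
  then have "Determinant.det (A t) = 0"
    using arg_cong[OF det_A[of t], of Re] by (simp add: case_prod_beta)
  then obtain v where v: "v \<in> carrier_vec n" "v \<noteq> 0\<^sub>v n" "A t *\<^sub>v v = 0\<^sub>v n"
    using det_0_iff_vec_prod_zero[OF carrier] by blast
  define x where "x i = vec_index v (i - 1)" for i
  have "x i = 0" if "i \<in> {1..n}" for i
  proof (rule M[OF _ _ that])
    show "cmod (cis t) = 1" by simp
    fix j assume j: "j \<in> {1..n}"
    have "Im (cis t powi k j * (\<Sum>i\<in>{1..n}. of_real (x i) * M i j)) =
        (\<Sum>i\<in>{1..n}. Im (cis t powi k j * M i j) * x i)"
      by (simp add: sum_distrib_left Im_sum algebra_simps)
    also have "\<dots> = (\<Sum>i\<in>{0..<n}. Im (cis t powi k j * M (Suc i) j) * vec_index v i)"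
      by (rule sum.reindex_bij_witness[of _ Suc "\<lambda>j. j - 1"]) (auto simp: x_def)
    also have "\<dots> = vec_index (A t *\<^sub>v v) (j - 1)"
      using j v(1) by (cases j) (auto simp: A_def scalar_prod_def)
    also have "\<dots> = 0" unfolding v(3) using j by (cases j) auto
    finally show "Im (cis t powi k j * (\<Sum>i\<in>{1..n}. of_real (x i) * M i j)) = 0" .
  qed
  then have "vec_index v i = 0" if "i < n" for i
    using that by (metis One_nat_def Suc_leI atLeastAtMost_iff diff_Suc_1 le_add1 plus_1_eq_Suc x_def)
  then have "v = 0\<^sub>v n" using v(1) by auto
  with v(2) show False by simp
qed

section \<open>Operations on admissible tuples\<close>

lemma unit_mult_cnj: "z * cnj z = 1" if "cmod z = 1"
  using complex_norm_square[of z] that by simp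

lemma unit_cnj_unique: "b = cnj a" if "cmod a = 1" "a * b = 1"
  using inverse_unique[OF that(2)] inverse_unique[OF unit_mult_cnj[OF that(1)]] by simp

text \<open>On the unit circle, negating the exponent conjugates the power. Conjugating the
  coordinate as well conjugates the whole product, which is real exactly when it was before.\<close>

lemma admissible_on_abs_cong:
  assumes "admissible_on J k'" and "\<And>j. j \<in> J \<Longrightarrow> \<bar>k j\<bar> = \<bar>k' j\<bar>"
  shows "admissible_on J k"
proof -
  obtain M where M: "\<And>z x i. cmod z = 1 \<Longrightarrow>
      (\<And>j. j \<in> J \<Longrightarrow> Im (z powi k' j * (\<Sum>i\<in>J. of_real (x i) * M i j)) = 0) \<Longrightarrow> i \<in> J \<Longrightarrow> x i = 0"
    using admissible_onE[OF assms(1)] by blast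
  show ?thesis
  proof (rule admissible_onI[where M = "\<lambda>i j. if k j = k' j then M i j else cnj (M i j)"])
    fix z x i
    assume z: "cmod z = 1" and i: "i \<in> J"
      and im: "\<And>j. j \<in> J \<Longrightarrow> Im (z powi k j *
          (\<Sum>i\<in>J. of_real (x i) * (if k j = k' j then M i j else cnj (M i j)))) = 0"
    show "x i = 0"
    proof (rule M[OF z _ i])
      fix j assume j: "j \<in> J"
      show "Im (z powi k' j * (\<Sum>i\<in>J. of_real (x i) * M i j)) = 0"
      proof (cases "k j = k' j")
        case True
        then show ?thesis using im[OF j] by simp
      next
        case False
        then have k: "k j = - k' j" using assms(2)[OF j] by linarith
        have "inverse z = cnj z" by (rule inverse_unique[OF unit_mult_cnj[OF z]])
        then have "z powi k j = cnj (z powi k' j)"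
          by (simp add: k power_int_minus power_int_inverse[symmetric])
        then have "z powi k j * (\<Sum>i\<in>J. of_real (x i) * cnj (M i j)) =
            cnj (z powi k' j * (\<Sum>i\<in>J. of_real (x i) * M i j))" by simp
        then show ?thesis using im[OF j] False by (simp del: complex_cnj_mult)
      qed
    qed
  qed
qed

text \<open>The two new coordinates carry the complex line spanned by (1, i), which the action preserves.\<close>

lemma admissible_on_insert_equal_pair:
  assumes "admissible_on J k" "finite J" "p \<notin> J" "q \<notin> J" "p \<noteq> q" "k p = k q"
  shows "admissible_on (insert p (insert q J)) k"
proof -
  obtain M where M: "\<And>z x i. cmod z = 1 \<Longrightarrow>
      (\<And>j. j \<in> J \<Longrightarrow> Im (z powi k j * (\<Sum>i\<in>J. of_real (x i) * M i j)) = 0) \<Longrightarrow> i \<in> J \<Longrightarrow> x i = 0"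
    using admissible_onE[OF assms(1)] by blast
  \<comment> \<open>With \<open>y = x p + \<i> * x q\<close>, the coordinates \<open>p\<close> and
    \<open>q\<close> of the combination are \<open>y\<close> and \<open>\<i> * y\<close>, and the
    others are those of \<open>M\<close>.\<close>
  define M' where "M' i j =
     (if i = p then if j = p then 1 else if j = q then \<i> else 0
      else if i = q then if j = p then \<i> else if j = q then -1 else 0
      else if j = p \<or> j = q then 0 else M i j)" for i j
  show ?thesis
  proof (rule admissible_onI[where M = M'])
    fix z x i
    assume z: "cmod z = 1" and i: "i \<in> insert p (insert q J)"
      and im: "\<And>j. j \<in> insert p (insert q J) \<Longrightarrow> Im (z powi k j *
          (\<Sum>i\<in>insert p (insert q J). of_real (x i) * M' i j)) = 0"
    have split: "(\<Sum>i\<in>insert p (insert q J). of_real (x i) * M' i j) =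
        of_real (x p) * M' p j + of_real (x q) * M' q j + (\<Sum>i\<in>J. of_real (x i) * M' i j)" for j
      using assms by simp
    have sumJ: "(\<Sum>i\<in>J. of_real (x i) * M' i j) =
        (if j = p \<or> j = q then 0 else \<Sum>i\<in>J. of_real (x i) * M i j)" for j
      using assms by (auto simp: M'_def intro!: sum.cong sum.neutral)
    define y where "y = Complex (x p) (x q)"
    have "of_real (x p) * M' p p + of_real (x q) * M' q p = y"
      "of_real (x p) * M' p q + of_real (x q) * M' q q = \<i> * y"
      using assms by (auto simp: M'_def y_def Complex_eq algebra_simps)
    then have "Im (z powi k p * y) = 0" "Im (z powi k p * (\<i> * y)) = 0"
      using im[of p] im[of q] assms unfolding split sumJ by simp_all
    then have "z powi k p * y = 0" by (simp add: complex_eq_iff)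
    then have "y = 0" using z by auto
    then have pq: "x p = 0" "x q = 0" by (auto simp: y_def Complex_eq_0)
    have "x i = 0" if "i \<in> J" for i
    proof (rule M[OF z _ that])
      fix j assume "j \<in> J"
      then show "Im (z powi k j * (\<Sum>i\<in>J. of_real (x i) * M i j)) = 0"
        using im[of j] assms(3,4) pq unfolding split sumJ by (auto split: if_splits)
    qed
    with i pq show "x i = 0" by auto
  qed
qed

text \<open>Opposite entries are first made equal by a sign change at \<open>p\<close>, which is
  undone after the insertion.\<close>

lemma admissible_on_insert_pair:
  assumes "admissible_on J k" "finite J" "p \<notin> J" "q \<notin> J" "p \<noteq> q" "\<bar>k p\<bar> = \<bar>k q\<bar>"
  shows "admissible_on (insert p (insert q J)) k"
proof -
  have "admissible_on J (k(p := k q))"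
    using assms by (intro admissible_on_abs_cong[OF assms(1)]) auto
  then have "admissible_on (insert p (insert q J)) (k(p := k q))"
    using assms by (intro admissible_on_insert_equal_pair) auto
  then show ?thesis
    by (rule admissible_on_abs_cong) (use assms in auto)
qed

text \<open>
  If c is the coordinate of frequency a + 2k, replace it by the coordinate cnj u of frequency a and
  by i(u - c) and u + c of frequency k, with u a new complex parameter. The last two are mapped to
  real numbers by z^k only if cnj u = z^(2k) c, and then z^a cnj u = z^(a + 2k) c.
\<close>

lemma admissible_on_split:
  assumes "admissible_on J (k(s := k s + 2 * k p))" "finite J" "s \<in> J"
    "p \<notin> J" "q \<notin> J" "p \<noteq> q" "k p = k q"
  shows "admissible_on (insert p (insert q J)) k"
proof -
  define k' where "k' = k(s := k s + 2 * k p)"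
  obtain M where M: "\<And>z x i. cmod z = 1 \<Longrightarrow>
      (\<And>j. j \<in> J \<Longrightarrow> Im (z powi k' j * (\<Sum>i\<in>J. of_real (x i) * M i j)) = 0) \<Longrightarrow> i \<in> J \<Longrightarrow> x i = 0"
    using admissible_onE[OF assms(1)[folded k'_def]] by blast
  \<comment> \<open>With \<open>u = x p + \<i> * x q\<close>, the new coordinates at
    \<open>s\<close>, \<open>p\<close>, \<open>q\<close> are \<open>cnj u\<close>,
    \<open>\<i> * (u - c)\<close> and \<open>u + c\<close>.\<close>
  define M' where "M' i j =
     (if i = p then if j = s then 1 else if j = p then \<i> else if j = q then 1 else 0
      else if i = q then if j = s then -\<i> else if j = p then -1 else if j = q then \<i> else 0
      else if j = s then 0 else if j = p then -\<i> * M i s else if j = q then M i s else M i j)" for i j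
  show ?thesis
  proof (rule admissible_onI[where M = M'])
    fix z x i
    assume z: "cmod z = 1" and i: "i \<in> insert p (insert q J)"
      and im: "\<And>j. j \<in> insert p (insert q J) \<Longrightarrow> Im (z powi k j *
          (\<Sum>i\<in>insert p (insert q J). of_real (x i) * M' i j)) = 0"
    define c where "c = (\<Sum>i\<in>J. of_real (x i) * M i s)"
    have split: "(\<Sum>i\<in>insert p (insert q J). of_real (x i) * M' i j) =
        of_real (x p) * M' p j + of_real (x q) * M' q j + (\<Sum>i\<in>J. of_real (x i) * M' i j)" for j
      using assms by simp
    have sumJ: "(\<Sum>i\<in>J. of_real (x i) * M' i j) =
        (if j = s then 0 else if j = p then -\<i> * c else if j = q then c
         else \<Sum>i\<in>J. of_real (x i) * M i j)" for j
      unfolding c_def sum_distrib_left using assms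
      by (auto simp: M'_def intro!: sum.cong sum.neutral)
    define u where "u = Complex (x p) (x q)"
    have ps: "s \<noteq> p" "s \<noteq> q" using assms by auto
    have "of_real (x p) * M' p s + of_real (x q) * M' q s = cnj u"
      "of_real (x p) * M' p p + of_real (x q) * M' q p + - \<i> * c = \<i> * (u - c)"
      "of_real (x p) * M' p q + of_real (x q) * M' q q = u"
      using assms ps by (auto simp: M'_def u_def Complex_eq algebra_simps)
    then have "Im (z powi k s * cnj u) = 0" "Im (z powi k p * (\<i> * (u - c))) = 0"
        "Im (z powi k p * (u + c)) = 0"
      using im[of s] im[of p] im[of q] assms ps unfolding split sumJ by simp_all
    \<comment> \<open>The two equations say that \<open>z powi k p * u\<close> and
      \<open>z powi k p * c\<close> have equal real parts and opposite imaginary parts.\<close>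
    moreover from this(2,3) have "cnj (z powi k p * u) = z powi k p * c"
      by (simp add: complex_eq_iff algebra_simps del: complex_cnj_power_int complex_cnj_mult)
    then have "z powi k p * cnj (z powi k p) * cnj u = z powi k p * z powi k p * c"
      by (simp add: mult.assoc)
    moreover have "z powi k p * cnj (z powi k p) = 1"
      using z by (intro unit_mult_cnj) (simp add: norm_power_int)
    moreover have "z \<noteq> 0" using z by auto
    ultimately have u: "cnj u = z powi k p * z powi k p * c"
      by (simp only: mult_1)
    have "z powi (k s + 2 * k p) * c = z powi k s * cnj u"
      unfolding u mult_2 using \<open>z \<noteq> 0\<close> by (simp only: power_int_add simp_thms mult_ac)
    with \<open>Im (z powi k s * cnj u) = 0\<close> have "Im (z powi (k s + 2 * k p) * c) = 0" by simp
    then have s: "Im (z powi k' s * c) = 0" by (simp add: k'_def)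
    have J: "x i = 0" if "i \<in> J" for i
    proof (rule M[OF z _ that])
      fix j assume "j \<in> J"
      then have "j \<noteq> p" "j \<noteq> q" "j \<noteq> s \<Longrightarrow> M' p j = 0" "j \<noteq> s \<Longrightarrow> M' q j = 0"
        using assms by (auto simp: M'_def)
      with \<open>j \<in> J\<close> show "Im (z powi k' j * (\<Sum>i\<in>J. of_real (x i) * M i j)) = 0"
        using im[of j] assms s unfolding split sumJ
        by (cases "j = s") (auto simp: k'_def c_def)
    qed
    then have "c = 0" by (simp add: c_def)
    then have "x p = 0" "x q = 0" using u by (auto simp: u_def Complex_eq_0)
    with i J show "x i = 0" by auto
  qed
qed

section \<open>Tuples of length at most four\<close>

text \<open>
  With A = z1 z2 and B = z1 z4 g, the two equations that remain after eliminating y and w have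
  determinant -((Im A)^2 + (Re B)^2).
\<close>

lemma four_coordinates_injective:
  fixes z1 z2 z3 z4 g y w :: complex
  assumes unit: "cmod z1 = 1" "cmod z2 = 1" "cmod z3 = 1" "cmod z4 = 1" "cmod g = 1"
    and prod: "z1 * z2 * (z3 * z4) = 1"
    and nondeg: "\<not> (Im (z1 * z2) = 0 \<and> Re (z1 * z4 * g) = 0)"
    and eq: "Im (z1 * (\<i> * cnj y - g * cnj w)) = 0" "Im (z2 * (\<i> * y)) = 0"
      "Im (z3 * (\<i> * cnj w - cnj g * cnj y)) = 0" "Im (z4 * (\<i> * w)) = 0"
  shows "y = 0" "w = 0"
proof -
  \<comment> \<open>The second and fourth equations make \<open>z2 * y\<close> and
    \<open>z4 * w\<close> purely imaginary, which leaves two real unknowns.\<close>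
  define s r where "s = Im (z2 * y)" and "r = Im (z4 * w)"
  have "z2 * y = \<i> * s" "z4 * w = \<i> * r"
    using eq by (auto simp: complex_eq_iff s_def r_def)
  then have yw: "y = \<i> * s * cnj z2" "w = \<i> * r * cnj z4"
    using unit_mult_cnj[OF unit(2)] unit_mult_cnj[OF unit(4)] by (metis mult.commute mult.left_commute mult.right_neutral)+
  define S C where "S = Im (z1 * z2)" and "C = Re (z1 * z4 * g)"
  have "z1 * (\<i> * cnj y - g * cnj w) = s * (z1 * z2) + \<i> * r * (z1 * z4 * g)"
    by (simp add: yw algebra_simps)
  then have 1: "s * S + r * C = 0"
    using eq(1) by (simp add: S_def C_def)
  \<comment> \<open>Since the four factors multiply to \<open>1\<close>, the third equation involves
    the conjugates of the same two products as the first.\<close>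
  have z34: "z3 * z4 = cnj (z1 * z2)"
    using prod unit by (intro unit_cnj_unique) (auto simp: norm_mult)
  have "z3 * z2 * cnj g = cnj (z1 * z4 * g)"
  proof -
    have "z1 * z4 * (z3 * z2) = 1" using prod by (simp add: mult_ac)
    then have "z3 * z2 = cnj (z1 * z4)"
      using unit by (intro unit_cnj_unique) (auto simp: norm_mult)
    then show ?thesis by simp
  qed
  moreover have "z3 * (\<i> * cnj w - cnj g * cnj y) = r * (z3 * z4) + \<i> * s * (z3 * z2 * cnj g)"
    by (simp add: yw algebra_simps)
  ultimately have "z3 * (\<i> * cnj w - cnj g * cnj y) = r * cnj (z1 * z2) + \<i> * s * cnj (z1 * z4 * g)"
    using z34 by metis
  then have 2: "s * C - r * S = 0"
    using eq(3) by (simp add: S_def C_def algebra_simps)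
  have "(s\<^sup>2 + r\<^sup>2) * (S\<^sup>2 + C\<^sup>2) = (s * S + r * C)\<^sup>2 + (s * C - r * S)\<^sup>2"
    by (simp add: algebra_simps power2_eq_square)
  moreover have "S\<^sup>2 + C\<^sup>2 \<noteq> 0"
    using nondeg by (auto simp: S_def C_def sum_power2_eq_zero_iff)
  ultimately have "s\<^sup>2 + r\<^sup>2 = 0"
    unfolding 1 2 by (metis mult_eq_0_iff power_zero_numeral add_0)
  then show "y = 0" "w = 0" by (auto simp: yw sum_power2_eq_zero_iff)
qed

text \<open>Here z^K real and z^L g imaginary would give g^(2K) = (-1)^K; the chosen g violates this.\<close>

lemma unit_multiplier_exists:
  fixes K L :: int
  assumes "K \<noteq> 0"
  obtains g where "cmod g = 1"
    "\<And>z. cmod z = 1 \<Longrightarrow> \<not> (Im (z powi K) = 0 \<and> Re (z powi L * g) = 0)"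
proof
  \<comment> \<open>Here \<open>g * g = - cis (pi / K)\<close>, whose \<open>K\<close>-th power is
    the negative of \<open>(-1) powi K\<close>.\<close>
  define g where "g = \<i> * cis (pi / (2 * K))"
  show "cmod g = 1" by (simp add: g_def norm_mult)
  have sq: "w * w = (if Im w = 0 then 1 else -1)" if "cmod w = 1" "Im w = 0 \<or> Re w = 0" for w
    using that by (auto simp: complex_eq_iff cmod_def power2_eq_square)
  fix z :: complex assume z: "cmod z = 1"
  then have "z \<noteq> 0" by auto
  show "\<not> (Im (z powi K) = 0 \<and> Re (z powi L * g) = 0)"
  proof
    assume *: "Im (z powi K) = 0 \<and> Re (z powi L * g) = 0"
    have a: "z powi K * z powi K = 1"
      using sq[of "z powi K"] * z by (simp add: norm_power_int)
    have n: "cmod (z powi L * g) = 1"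
      using z \<open>cmod g = 1\<close> by (simp add: norm_mult norm_power_int)
    have b: "(z powi L * g) * (z powi L * g) = -1"
      using sq[OF n] * n by (auto simp: cmod_def complex_eq_iff split: if_splits)
    \<comment> \<open>The \<open>K\<close>-th power of the square of \<open>z powi L * g\<close> is
      evaluated in two ways, using that \<open>z powi K\<close> squares to \<open>1\<close>.\<close>
    have "(-1) powi K = ((z powi L * g) * (z powi L * g)) powi K"
      by (simp add: b)
    also have "\<dots> = (z powi K * z powi K) powi L * (g * g) powi K"
      by (simp add: power_int_mult_distrib power_int_mult[symmetric] mult_ac)
    also have "(g * g) = - cis (pi / K)"
      using assms by (simp add: g_def cis_mult field_simps)
    also have "\<dots> powi K = (-1) powi K * cis (pi / K) powi K"
      by (metis mult_minus1 power_int_mult_distrib)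
    also have "cis (pi / K) powi K = -1"
      using assms by (simp add: cis_power_int)
    finally have "(-1) powi K = (0 :: complex)" by (simp add: a)
    then show False by simp
  qed
qed

lemma admissible_on_empty: "admissible_on {} k"
  by (simp add: admissible_on_def)

text \<open>At frequency \<open>0\<close> the action is trivial, and the imaginary axis meets the
  reals only in \<open>0\<close>.\<close>

lemma admissible_on_singleton: "admissible_on {p} k" if "k p = 0"
  by (rule admissible_onI[where M = "\<lambda>_ _. \<i>"]) (use that in auto)

lemma admissible_on_doubleton: "admissible_on {p, q} k" if "p \<noteq> q" "k p + k q = 0"
  using admissible_on_insert_pair[OF admissible_on_empty[of k], of p q] that by auto

text \<open>The four-coordinate construction with a fourth entry \<open>0\<close>: taking
  \<open>w\<close> imaginary makes its fourth equation automatic.\<close>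

lemma admissible_on_three:
  assumes "distinct [p1, p2, p3]" and sum: "k p1 + k p2 + k p3 = 0"
  shows "admissible_on {p1, p2, p3} k"
proof (cases "k p1 + k p2 = 0")
  case True
  then have "admissible_on {p3} k" using sum by (intro admissible_on_singleton) simp
  then show ?thesis using admissible_on_insert_pair[of "{p3}" k p1 p2] assms True by auto
next
  case False
  then obtain g where g: "cmod g = 1"
    "\<And>z. cmod z = 1 \<Longrightarrow> \<not> (Im (z powi (k p1 + k p2)) = 0 \<and> Re (z powi k p1 * g) = 0)"
    using unit_multiplier_exists by metis
  define R where "R j y w = (if j = p1 then \<i> * cnj y - g * cnj w else if j = p2 then \<i> * y
      else \<i> * cnj w - cnj g * cnj y)" for j and y w :: complex
  define M where "M i j = R j (if i = p1 then 1 else if i = p2 then \<i> else 0) (if i = p3 then \<i> else 0)" for i j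
  show ?thesis
  proof (rule admissible_onI[where M = M])
    fix z x i
    assume z: "cmod z = 1" and i: "i \<in> {p1, p2, p3}"
      and im: "\<And>j. j \<in> {p1, p2, p3} \<Longrightarrow> Im (z powi k j * (\<Sum>i\<in>{p1, p2, p3}. of_real (x i) * M i j)) = 0"
    define y w where "y = Complex (x p1) (x p2)" and "w = \<i> * x p3"
    have eq: "Im (z powi k j * R j y w) = 0" if "j \<in> {p1, p2, p3}" for j
    proof -
      have "(\<Sum>i\<in>{p1, p2, p3}. of_real (x i) * M i j) = R j y w"
        using assms by (auto simp: M_def R_def y_def w_def Complex_eq algebra_simps)
      then show ?thesis using im[OF that] by simp
    qed
    have "z \<noteq> 0" using z by auto
    have p: "z powi k p1 * z powi k p2 * (z powi k p3 * 1) = 1"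
      using sum \<open>z \<noteq> 0\<close> by (simp flip: power_int_add)
    have "y = 0 \<and> w = 0"
      using four_coordinates_injective[OF _ _ _ _ g(1) p, of y w] eq[of p1] eq[of p2] eq[of p3]
        g(2)[OF z] z \<open>z \<noteq> 0\<close> assms
      by (auto simp: R_def norm_power_int power_int_add w_def)
    then show "x i = 0" using i by (auto simp: y_def w_def Complex_eq_0)
  qed
qed

text \<open>If \<open>k p1 + k p2 = 0\<close>, the tuple decomposes into two opposite pairs.
  Otherwise the vectors \<open>R j y w\<close>, real-linear in two complex parameters, form the
  subspace, with \<open>K = k p1 + k p2\<close> and \<open>L = k p1 + k p4\<close>.\<close>

lemma admissible_on_four:
  assumes "distinct [p1, p2, p3, p4]" and sum: "k p1 + k p2 + k p3 + k p4 = 0"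
  shows "admissible_on {p1, p2, p3, p4} k"
proof (cases "k p1 + k p2 = 0")
  case True
  then have "admissible_on {p3, p4} k" using sum assms by (intro admissible_on_doubleton) auto
  then show ?thesis using admissible_on_insert_pair[of "{p3, p4}" k p1 p2] assms True by auto
next
  case False
  then obtain g where g: "cmod g = 1"
    "\<And>z. cmod z = 1 \<Longrightarrow> \<not> (Im (z powi (k p1 + k p2)) = 0 \<and> Re (z powi (k p1 + k p4) * g) = 0)"
    using unit_multiplier_exists by metis
  define R where "R j y w = (if j = p1 then \<i> * cnj y - g * cnj w else if j = p2 then \<i> * y
      else if j = p3 then \<i> * cnj w - cnj g * cnj y else \<i> * w)" for j and y w :: complex
  \<comment> \<open>The values of \<open>R\<close> at the real basis of the parameter space:
    \<open>y\<close> or \<open>w\<close> equal to \<open>1\<close> or \<open>\<i>\<close>, the other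
    one \<open>0\<close>.\<close>
  define M where "M i j = R j (if i = p1 then 1 else if i = p2 then \<i> else 0)
      (if i = p3 then 1 else if i = p4 then \<i> else 0)" for i j
  show ?thesis
  proof (rule admissible_onI[where M = M])
    fix z x i
    assume z: "cmod z = 1" and i: "i \<in> {p1, p2, p3, p4}"
      and im: "\<And>j. j \<in> {p1, p2, p3, p4} \<Longrightarrow>
        Im (z powi k j * (\<Sum>i\<in>{p1, p2, p3, p4}. of_real (x i) * M i j)) = 0"
    define y w where "y = Complex (x p1) (x p2)" and "w = Complex (x p3) (x p4)"
    have eq: "Im (z powi k j * R j y w) = 0" if "j \<in> {p1, p2, p3, p4}" for j
    proof -
      have "(\<Sum>i\<in>{p1, p2, p3, p4}. of_real (x i) * M i j) = R j y w"
        using assms by (auto simp: M_def R_def y_def w_def Complex_eq algebra_simps)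
      then show ?thesis using im[OF that] by simp
    qed
    have "z \<noteq> 0" using z by auto
    have p: "z powi k p1 * z powi k p2 * (z powi k p3 * z powi k p4) = 1"
      using sum \<open>z \<noteq> 0\<close> by (simp add: add.assoc flip: power_int_add)
    have "y = 0 \<and> w = 0"
      using four_coordinates_injective[OF _ _ _ _ g(1) p, of y w] eq[of p1] eq[of p2] eq[of p3] eq[of p4]
        g(2)[OF z] z \<open>z \<noteq> 0\<close> assms
      by (auto simp: R_def norm_power_int power_int_add)
    then show "x i = 0" using i by (auto simp: y_def w_def Complex_eq_0)
  qed
qed

lemma admissible_on_card_le_four:
  assumes "finite J" "card J \<le> 4" "(\<Sum>j\<in>J. k j) = 0"
  shows "admissible_on J k"
proof -
  obtain xs where xs: "set xs = J" "distinct xs"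
    using finite_distinct_list[OF assms(1)] by blast
  then have "length xs \<le> 4" using assms(2) distinct_card by fastforce
  then consider "xs = []" | p where "xs = [p]" | p q where "xs = [p, q]"
    | p q r where "xs = [p, q, r]" | p q r s where "xs = [p, q, r, s]"
    by (auto simp: numeral_eq_Suc le_Suc_eq length_Suc_conv)
  then show ?thesis
    using xs assms(3) admissible_on_empty admissible_on_singleton[of k] admissible_on_doubleton[of _ _ k]
      admissible_on_three[of _ _ _ k] admissible_on_four[of _ _ _ _ k]
    by cases (auto simp: add.assoc)
qed

section \<open>Sufficiency\<close>

text \<open>The last pair is removed in each step: a cancelling pair is split off, any other is
  absorbed by an entry of \<open>L\<close>, which keeps the sum \<open>0\<close>. With
  \<open>L\<close> empty nothing can absorb a pair, but pairs alone are admissible whatever their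
  sum; hence the disjunction.\<close>

lemma admissible_on_pairs_and_four:
  assumes "finite L" "card L \<le> 4" "L \<inter> {1..2 * m} = {}"
    and "\<And>j. j \<in> {1..m} \<Longrightarrow> \<bar>k (2 * j - 1)\<bar> = \<bar>k (2 * j)\<bar>"
    and "L = {} \<or> (\<Sum>j\<in>{1..2 * m} \<union> L. k j) = 0"
  shows "admissible_on ({1..2 * m} \<union> L) k"
  using assms(3-5)
proof (induction m arbitrary: k)
  case 0
  then show ?case
    using assms(1,2) by (auto intro!: admissible_on_card_le_four)
next
  case (Suc m)
  define J p q where "J = {1..2 * m} \<union> L" and "p = Suc (2 * m)" and "q = Suc (Suc (2 * m))"
  have JS: "{1..2 * Suc m} \<union> L = insert p (insert q J)"
    by (auto simp: J_def p_def q_def)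
  have J: "finite J" "p \<notin> J" "q \<notin> J" "p \<noteq> q"
    using assms(1) Suc.prems(1) by (auto simp: J_def p_def q_def)
  have L: "L \<inter> {1..2 * m} = {}" using Suc.prems(1) by auto
  have abs: "\<bar>k p\<bar> = \<bar>k q\<bar>" using Suc.prems(2)[of "Suc m"] by (simp add: p_def q_def)
  have sum: "L = {} \<or> k p + k q + (\<Sum>j\<in>J. k j) = 0"
    using Suc.prems(3) J unfolding JS by (auto simp: add.assoc)
  show ?case
  proof (cases "L = {} \<or> k p + k q = 0")
    case True
    then have "admissible_on J k"
      unfolding J_def using sum L Suc.prems(2) by (intro Suc.IH) (auto simp: J_def)
    then show ?thesis
      unfolding JS using J abs by (intro admissible_on_insert_pair)
  next
    case False
    then have pq: "k p = k q" using abs by linarith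
    obtain s where s: "s \<in> L" using False by blast
    \<comment> \<open>As \<open>s\<close> lies in \<open>L\<close>, the remaining pairs keep their
      values, so the induction hypothesis applies to \<open>k'\<close>.\<close>
    define k' where "k' = k(s := k s + 2 * k p)"
    have "s \<in> J" using s by (simp add: J_def)
    then have "(\<Sum>j\<in>J. k' j) = 2 * k p + (\<Sum>j\<in>J. k j)"
      using J(1) by (simp add: k'_def sum.remove[of J s])
    then have "(\<Sum>j\<in>J. k' j) = 0" using sum pq False by auto
    moreover have "k' j = k j" if "j \<in> {1..2 * m}" for j
      using that s L by (auto simp: k'_def)
    moreover have "2 * j - 1 \<in> {1..2 * m}" "2 * j \<in> {1..2 * m}" if "j \<in> {1..m}" for j
      using that by auto
    ultimately have "admissible_on J k'"
      unfolding J_def using Suc.prems(2) L by (intro Suc.IH) (simp_all add: J_def)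
    then show ?thesis
      unfolding JS k'_def using J pq \<open>s \<in> J\<close> by (intro admissible_on_split)
  qed
qed

theorem corollary6p12:
  fixes m l :: nat and k :: "nat \<Rightarrow> int"
  assumes "l \<le> 4"
    and "\<And>j. j \<in> {1..2 * m + l} \<Longrightarrow> k j \<noteq> 0"
    and "\<And>j. j \<in> {1..m} \<Longrightarrow> k (2 * j - 1) = k (2 * j)"
  shows "R_admissible (2 * m + l) k \<longleftrightarrow>
    (\<exists>\<kappa> :: nat \<Rightarrow> int. (\<forall>j\<in>{1..2 * m + l}. \<kappa> j \<in> {1, -1}) \<and>
       (\<Sum>j=1..2 * m + l. \<kappa> j * k j) = 0)"
proof
  assume "R_admissible (2 * m + l) k"
  then show "\<exists>\<kappa> :: nat \<Rightarrow> int. (\<forall>j\<in>{1..2 * m + l}. \<kappa> j \<in> {1, -1}) \<and>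
       (\<Sum>j=1..2 * m + l. \<kappa> j * k j) = 0"
    unfolding R_admissible_def
    using good_subspace_imp_admissible_on admissible_on_imp_signed_sum_zero by blast
next
  assume "\<exists>\<kappa> :: nat \<Rightarrow> int. (\<forall>j\<in>{1..2 * m + l}. \<kappa> j \<in> {1, -1}) \<and>
       (\<Sum>j=1..2 * m + l. \<kappa> j * k j) = 0"
  then obtain \<kappa> :: "nat \<Rightarrow> int" where \<kappa>: "\<And>j. j \<in> {1..2 * m + l} \<Longrightarrow> \<kappa> j \<in> {1, -1}"
      "(\<Sum>j=1..2 * m + l. \<kappa> j * k j) = 0"
    by blast
  have abs: "\<bar>\<kappa> j * k j\<bar> = \<bar>k j\<bar>" if "j \<in> {1..2 * m + l}" for j
    using \<kappa>(1)[OF that] by (auto simp: abs_mult)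
  have split: "{1..2 * m + l} = {1..2 * m} \<union> {2 * m + 1..2 * m + l}" by auto
  \<comment> \<open>Moving the signs into the entries gives an ordinary zero sum. The two entries of
    a pair may then differ in sign, but not in absolute value.\<close>
  have "admissible_on ({1..2 * m} \<union> {2 * m + 1..2 * m + l}) (\<lambda>j. \<kappa> j * k j)"
  proof (rule admissible_on_pairs_and_four)
    fix j assume j: "j \<in> {1..m}"
    then have "2 * j - 1 \<in> {1..2 * m + l}" "2 * j \<in> {1..2 * m + l}" by auto
    then show "\<bar>\<kappa> (2 * j - 1) * k (2 * j - 1)\<bar> = \<bar>\<kappa> (2 * j) * k (2 * j)\<bar>"
      using abs assms(3)[OF j] by metis
  next
    show "{2 * m + 1..2 * m + l} = {} \<or>
        (\<Sum>j\<in>{1..2 * m} \<union> {2 * m + 1..2 * m + l}. \<kappa> j * k j) = 0"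
      using \<kappa>(2) unfolding split by blast
  qed (use assms(1) in auto)
  then have "admissible_on {1..2 * m + l} k"
    unfolding split[symmetric] by (rule admissible_on_abs_cong) (use abs in auto)
  then show "R_admissible (2 * m + l) k"
    unfolding R_admissible_def using assms(2) admissible_on_imp_good_subspace by blast
qed

end
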